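(* Let $f(z)=\sum_{n=1}^\infty a_nz^n$ be a Schwarz function, i.e. $f\in\mathcal{B}$ with $f(0)=0$, let $\omega\in\mathcal{B}_m$ for some $m\in\mathbb{N}$, let $p\in(0,2]$, and let $\varphi=\{\varphi_n(r)\}_{n=0}^{\infty}\in\mathcal{F}$. Define $$\Psi_4(r):=\frac p2\varphi_0(r)-\sum_{n=1}^\infty(n+1)\varphi_n(r)-r^m\frac{2-r^m}{(1-r^m)^2},$$ and let $R_4=R_4(m,p)$ be the minimal positive root of the equation $\Psi_4(r)=0$. If $\Psi_4(r)\ge0$ for $0\le r\le R_4$, then, for $z\in\mathbb{D}$ with $|z|=r$, $$D_{f'}(\varphi,p,r):=|a_1|^p\varphi_0(r)+\sum_{n=1}^\infty(n+1)|a_{n+1}|\varphi_n(r)+|f'(\omega(z))-a_1|\le\varphi_0(r)\quad\text{for } r\le R_4.$$ Moreover, in the case when $\Psi_4(r)<0$ in some interval $(R_4,R_4+\varepsilon)$ with $\varepsilon>0$, the number $R_4$ cannot be improved.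
   Context: $\mathbb{D}=\{z\in\mathbb{C}:|z|<1\}$ and $\mathbb{N}=\{1,2,\ldots\}$. $\mathcal{B}$ is the set of analytic functions $f$ on $\mathbb{D}$ with $\sup_{z\in\mathbb{D}}|f(z)|\le 1$. For $m\in\mathbb{N}$, $\mathcal{B}_m=\{\omega\in\mathcal{B}:\omega(0)=\cdots=\omega^{(m-1)}(0)=0,\ \omega^{(m)}(0)\ne0\}$. $\mathcal{F}$ is the set of all sequences $\varphi=\{\varphi_n(r)\}_{n=0}^\infty$ of nonnegative continuous functions on $[0,1)$ such that $\sum_{n=0}^\infty\varphi_n(r)$ converges locally uniformly on $[0,1)$. The equation $\Psi_4(r)=0$ is considered for $r\in[0,1)$. "The number $R_4$ cannot be improved" means that, for the given $m,p,\varphi$, $R_4$ cannot be replaced by a larger number: for every $R'\in(R_4,1]$ there exist a Schwarz function $f$, $\omega\in\mathcal{B}_m$ and $z$ with $|z|=r<R'$ such that $D_{f'}(\varphi,p,r)>\varphi_0(r)$. *)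

theory Defs
  imports "HOL-Complex_Analysis.Complex_Analysis"
begin

definition unit_bounded :: "(complex \<Rightarrow> complex) set" where
  "unit_bounded =
     {f. f holomorphic_on ball 0 1 \<and> (\<forall>z\<in>ball 0 1. cmod (f z) \<le> 1)}"

definition unit_bounded_order :: "nat \<Rightarrow> (complex \<Rightarrow> complex) set" where
  "unit_bounded_order m =
     {\<omega> \<in> unit_bounded. (\<forall>k<m. (deriv ^^ k) \<omega> 0 = 0) \<and> (deriv ^^ m) \<omega> 0 \<noteq> 0}"

definition schwarz_function :: "(complex \<Rightarrow> complex) \<Rightarrow> bool" where
  "schwarz_function f \<longleftrightarrow> f \<in> unit_bounded \<and> f 0 = 0"

definition taylor_coeff :: "(complex \<Rightarrow> complex) \<Rightarrow> nat \<Rightarrow> complex" where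
  "taylor_coeff f n = fps_nth (fps_expansion f 0) n"

text \<open>Locally uniform convergence on \<open>[0,1)\<close>: every point has a relative
  neighbourhood on which the partial sums converge uniformly.\<close>

definition weight_seqs :: "(nat \<Rightarrow> real \<Rightarrow> real) set" where
  "weight_seqs = {\<phi>.
     (\<forall>n. continuous_on {0..<1} (\<phi> n)) \<and>
     (\<forall>n. \<forall>r\<in>{0..<1}. 0 \<le> \<phi> n r) \<and>
     (\<forall>r\<in>{0..<1}. \<exists>d>0. uniformly_convergent_on ({0..<1} \<inter> ball r d)
                               (\<lambda>N x. \<Sum>n<N. \<phi> n x))}"

text \<open>Convergence of \<open>\<Sum> \<phi>\<^sub>n(r)\<close> does not imply convergence of
  \<open>\<Sum> (n+1) \<phi>\<^sub>n(r)\<close>.  Series of nonnegative terms are therefore summed in the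
  extended reals, where they always have a value in \<open>[0,\<infinity>]\<close>; if all series
  involved converge this is the ordinary real-valued expression.  Where the series
  diverges, \<open>Psi m p \<phi> r = -\<infinity>\<close>.  Both series start at index 1, whence the
  shift \<open>Suc n\<close>.\<close>

definition Psi :: "nat \<Rightarrow> real \<Rightarrow> (nat \<Rightarrow> real \<Rightarrow> real) \<Rightarrow> real \<Rightarrow> ereal" where
  "Psi m p \<phi> r =
     ereal (p / 2 * \<phi> 0 r)
     - (\<Sum>n. ereal ((real (Suc n) + 1) * \<phi> (Suc n) r))
     - ereal (r ^ m * ((2 - r ^ m) / (1 - r ^ m)\<^sup>2))"

definition minimal_positive_root :: "(real \<Rightarrow> ereal) \<Rightarrow> real \<Rightarrow> bool" where
  "minimal_positive_root g R \<longleftrightarrow>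
     0 < R \<and> R < 1 \<and> g R = 0 \<and> (\<forall>r. 0 < r \<and> r < R \<longrightarrow> g r \<noteq> 0)"

text \<open>The functional for the derivative of \<open>f\<close>, evaluated at \<open>z\<close> with
  \<open>r = |z|\<close>; it depends on \<open>\<omega>\<close> and \<open>z\<close> through its last term.\<close>

definition D_deriv ::
  "(complex \<Rightarrow> complex) \<Rightarrow> (complex \<Rightarrow> complex) \<Rightarrow> (nat \<Rightarrow> real \<Rightarrow> real) \<Rightarrow> real \<Rightarrow> complex \<Rightarrow> ereal"
where
  "D_deriv f \<omega> \<phi> p z =
     ereal (cmod (taylor_coeff f 1) powr p * \<phi> 0 (cmod z))
     + (\<Sum>n. ereal ((real (Suc n) + 1) * cmod (taylor_coeff f (Suc n + 1)) * \<phi> (Suc n) (cmod z)))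
     + ereal (cmod (deriv f (\<omega> z) - taylor_coeff f 1))"

end

theory Submission
  imports Defs
begin

text \<open>Write \<open>f z = z g z\<close> and \<open>a = |a\<^sub>1| = |g 0|\<close>.  Then \<open>|a\<^sub>n| \<le> 1 - a\<^sup>2\<close> for \<open>n \<ge> 2\<close>, and
  \<open>|\<omega> z| \<le> r\<^sup>m\<close> by the Schwarz lemma, so the functional is at most
  \<open>a\<^sup>p \<phi>\<^sub>0(r) + (1 - a\<^sup>2) (p/2 \<phi>\<^sub>0(r) - \<Psi>(r))\<close>.  Where \<open>\<Psi>(r) \<ge> 0\<close>, the bound follows from
  \<open>a\<^sup>p \<le> 1 - p/2 (1 - a\<^sup>2)\<close>, which is where \<open>p \<le> 2\<close> enters.
  For \<open>f z = z (a - z) / (1 - a z)\<close> and \<open>\<omega> z = z\<^sup>m\<close>, the excess of the functional over \<open>\<phi>\<^sub>0(r)\<close>,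
  divided by \<open>1 - a\<^sup>2\<close>, tends to \<open>-\<Psi>(r)\<close> as \<open>a \<rightarrow> 1\<close>; since \<open>\<Psi>(r)\<close> may be \<open>-\<infinity>\<close>,
  the limit is taken for a finite section of the series.\<close>

section \<open>Power series on the unit disc\<close>

lemma taylor_coeff_sums:
  assumes "f holomorphic_on ball 0 1" "z \<in> ball 0 1"
  shows "(\<lambda>n. taylor_coeff f n * z ^ n) sums f z"
  using holomorphic_power_series[OF assms] by (simp add: taylor_coeff_def fps_expansion_def)

lemma taylor_coeff_unique:
  assumes "\<And>z. z \<in> ball 0 1 \<Longrightarrow> (\<lambda>n. c n * z ^ n) sums f z"
  shows "taylor_coeff f n = c n"
proof -
  have "\<forall>\<^sub>F z in nhds 0. z \<in> ball (0::complex) 1"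
    by (rule eventually_nhds_in_open) auto
  then have "\<forall>\<^sub>F z in nhds 0. (\<lambda>n. fps_nth (Abs_fps c) n * z ^ n) sums f z"
    by eventually_elim (use assms in simp)
  then have "f has_fps_expansion Abs_fps c"
    by (rule has_fps_expansionI)
  then show ?thesis
    by (simp add: taylor_coeff_def fps_expansion_eqI)
qed

text \<open>Dividing out the zero termwise presents the cofactor \<open>g\<close> as a power series
  on the whole disc, so its holomorphy at 0 needs no separate argument.\<close>

lemma sums_shift_factor:
  fixes c :: "nat \<Rightarrow> complex"
  assumes "\<And>z. z \<in> ball 0 1 \<Longrightarrow> (\<lambda>n. c n * z ^ n) sums f z" "\<And>k. k < m \<Longrightarrow> c k = 0"
  obtains g where "\<And>z. z \<in> ball 0 1 \<Longrightarrow> (\<lambda>n. c (n + m) * z ^ n) sums g z"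
    and "\<And>z. z \<in> ball 0 1 \<Longrightarrow> f z = z ^ m * g z"
proof -
  let ?g = "\<lambda>z. if z = 0 then c m else f z / z ^ m"
  have shifted: "(\<lambda>n. c (n + m) * z ^ (n + m)) sums f z" if "z \<in> ball 0 1" for z
    using sums_split_initial_segment[OF assms(1)[OF that], of m] assms(2) by simp
  have "(\<lambda>n. c (n + m) * z ^ n) sums ?g z" if "z \<in> ball 0 1" for z
  proof (cases "z = 0")
    case True
    then show ?thesis using powser_sums_zero[of "\<lambda>n. c (n + m)"] by simp
  next
    case False
    then show ?thesis using sums_divide[OF shifted[OF that], of "z ^ m"]
      by (simp add: power_add)
  qed
  moreover have "f z = z ^ m * ?g z" if "z \<in> ball 0 1" for z
  proof (cases "z = 0")
    case True
    then have "f z = c 0"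
      using sums_unique2[OF assms(1)[OF that], of "c 0"] powser_sums_zero[of c] by simp
    with True show ?thesis using assms(2)[of 0] by (cases m) auto
  qed simp
  ultimately show ?thesis by (rule that)
qed

section \<open>Coefficient bounds for functions bounded by 1\<close>

text \<open>On the circle of radius \<rho> the factor \<open>z ^ m\<close> has modulus
  \<open>\<rho> ^ m\<close>, so the maximum modulus principle gives
  \<open>cmod (g z) \<le> 1 / \<rho> ^ m\<close>; then \<rho> tends to 1.\<close>

lemma norm_le_one_of_norm_power_mult_le_one:
  assumes "g holomorphic_on ball 0 1" "\<And>z. z \<in> ball 0 1 \<Longrightarrow> cmod (z ^ m * g z) \<le> 1"
    and z: "z \<in> ball 0 1"
  shows "cmod (g z) \<le> 1"
proof -
  have bound: "cmod (g z) * \<rho> ^ m \<le> 1" if "cmod z < \<rho>" "\<rho> < 1" for \<rho>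
  proof -
    have \<rho>: "\<rho> > 0" using that(1) by (meson norm_ge_zero le_less_trans)
    have sub: "cball 0 \<rho> \<subseteq> ball (0::complex) 1" using that by auto
    have "cmod (g z) \<le> 1 / \<rho> ^ m"
    proof (rule maximum_modulus_frontier[of g "cball 0 \<rho>"])
      show "g holomorphic_on interior (cball 0 \<rho>)"
        using assms(1) sub interior_subset by (blast intro: holomorphic_on_subset)
      show "continuous_on (closure (cball 0 \<rho>)) g"
        using assms(1) sub by (simp add: holomorphic_on_imp_continuous_on holomorphic_on_subset)
      show "cmod (g w) \<le> 1 / \<rho> ^ m" if "w \<in> frontier (cball 0 \<rho>)" for w
      proof -
        have "cmod w = \<rho>" using that \<rho> by simp
        then show ?thesis
          using assms(2)[of w] \<rho> \<open>\<rho> < 1\<close> by (simp add: norm_mult norm_power field_simps)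
      qed
    qed (use that in auto)
    then show ?thesis using \<rho> by (simp add: field_simps)
  qed
  have "((\<lambda>\<rho>. cmod (g z) * \<rho> ^ m) \<longlongrightarrow> cmod (g z) * 1 ^ m) (at_left 1)"
    by (intro tendsto_intros)
  moreover have "\<forall>\<^sub>F \<rho> in at_left 1. cmod (g z) * \<rho> ^ m \<le> 1"
    using z bound by (auto simp: eventually_at_left_field)
  ultimately show ?thesis
    using tendsto_upperbound by fastforce
qed

lemma sum_powers_root_of_unity:
  fixes \<zeta> :: complex
  assumes "\<zeta> ^ n = 1" "\<zeta> ^ j \<noteq> 1"
  shows "(\<Sum>k<n. (\<zeta> ^ k) ^ j) = 0"
proof -
  have "(\<Sum>k<n. (\<zeta> ^ k) ^ j) = (\<Sum>k<n. (\<zeta> ^ j) ^ k)"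
    by (simp add: mult.commute flip: power_mult)
  also have "\<dots> = ((\<zeta> ^ j) ^ n - 1) / (\<zeta> ^ j - 1)"
    using assms by (simp add: geometric_sum)
  also have "(\<zeta> ^ j) ^ n = 1"
    by (metis assms(1) mult.commute power_mult power_one)
  finally show ?thesis by simp
qed

text \<open>Averaging over the \<open>n\<close>-th roots of unity kills the coefficients strictly between
  \<open>0\<close> and \<open>n\<close>, which reduces the bound to the Schwarz lemma for a Moebius transform.\<close>

lemma norm_coeff_le_strict:
  fixes c :: "nat \<Rightarrow> complex"
  assumes sums: "\<And>z. z \<in> ball 0 1 \<Longrightarrow> (\<lambda>n. c n * z ^ n) sums g z"
    and less: "\<And>z. z \<in> ball 0 1 \<Longrightarrow> cmod (g z) < 1"
    and n: "n > 0"
  shows "cmod (c n) \<le> 1 - (cmod (c 0))\<^sup>2"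
proof -
  define \<zeta> where "\<zeta> = exp (2 * of_real pi * \<i> * of_nat 1 / of_nat n)"
  have \<zeta>: "\<zeta> ^ n = 1"
    unfolding \<zeta>_def by (rule complex_root_unity) (use n in simp)
  have \<zeta>': "\<zeta> ^ j \<noteq> 1" if "0 < j" "j < n" for j
  proof -
    have "\<zeta> ^ j = exp (2 * of_real pi * \<i> * of_nat j / of_nat n)"
      unfolding \<zeta>_def by (simp add: field_simps flip: exp_of_nat_mult)
    with that complex_root_unity_eq_1[of n j] show ?thesis by (auto dest: nat_dvd_not_less)
  qed
  have norm_\<zeta>: "cmod (\<zeta> ^ k) = 1" for k
    by (metis \<zeta> n norm_power norm_one power_eq_1_iff power_one less_irrefl)
  \<comment> \<open>These are the coefficients of the average \<open>G\<close>: the inner sum is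
    \<open>n\<close> for \<open>j = 0\<close> and \<open>j = n\<close>, and 0 strictly in
    between.\<close>
  define e where "e j = c j * (\<Sum>k<n. (\<zeta> ^ k) ^ j) / of_nat n" for j
  define G where "G z = (\<Sum>k<n. g (\<zeta> ^ k * z)) / of_nat n" for z
  have mem: "\<zeta> ^ k * z \<in> ball 0 1" if "z \<in> ball 0 1" for k z
    using that norm_\<zeta>[of k] by (simp add: norm_mult)
  have G_sums: "(\<lambda>j. e j * z ^ j) sums G z" if "z \<in> ball 0 1" for z
  proof -
    have "(\<lambda>j. (\<Sum>k<n. c j * (\<zeta> ^ k * z) ^ j) / of_nat n) sums G z"
      unfolding G_def by (intro sums_divide sums_sum sums mem that)
    then show ?thesis
      unfolding e_def by (simp add: power_mult_distrib sum_distrib_left sum_distrib_right mult.assoc)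
  qed
  have G_less: "cmod (G z) < 1" if "z \<in> ball 0 1" for z
  proof -
    have "cmod (\<Sum>k<n. g (\<zeta> ^ k * z)) \<le> (\<Sum>k<n. cmod (g (\<zeta> ^ k * z)))"
      by (rule norm_sum)
    also have "\<dots> < (\<Sum>k<n. 1)"
      using n by (intro sum_strict_mono less mem that) auto
    finally show ?thesis using n by (simp add: G_def norm_divide field_simps)
  qed
  have "(\<zeta> ^ k) ^ n = 1" for k
    by (metis \<zeta> mult.commute power_mult power_one)
  then have e0: "e 0 = c 0" and en: "e n = c n"
    using n by (simp_all add: e_def)
  have c0: "cmod (c 0) < 1"
    using less[of 0] sums[of 0] powser_sums_zero[of c] sums_unique2 by fastforce
  have a: "(\<lambda>j. (if j = 0 then 0 else e j) * z ^ j) sums (G z - c 0)" if "z \<in> ball 0 1" for z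
  proof -
    have "(\<lambda>j. if j = 0 then c 0 else 0) sums c 0"
      using sums_single[of 0 "\<lambda>_. c 0"] by simp
    from sums_diff[OF G_sums[OF that] this] show ?thesis
      by (rule sums_cong[THEN iffD1, rotated]) (auto simp: e0)
  qed
  have b: "(if j = 0 then 0 else e j) = 0" if "j < n" for j
    using that sum_powers_root_of_unity[OF \<zeta> \<zeta>'] by (auto simp: e_def)
  obtain q where
    q: "\<And>z. z \<in> ball 0 1 \<Longrightarrow> (\<lambda>j. (if j + n = 0 then 0 else e (j + n)) * z ^ j) sums q z"
    and Gq: "\<And>z. z \<in> ball 0 1 \<Longrightarrow> G z - c 0 = z ^ n * q z"
    by (rule sums_shift_factor[OF a b]) blast+
  \<comment> \<open>\<open>z ^ n * N z\<close> is \<open>G z\<close> followed by the disc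
    automorphism sending \<open>c 0\<close> to 0, hence of modulus below 1. So
    \<open>cmod (N 0) \<le> 1\<close>, while \<open>N 0\<close> is \<open>c n\<close> divided by
    \<open>1 - (cmod (c 0))\<^sup>2\<close>.\<close>
  define N where "N z = q z / (1 - cnj (c 0) * G z)" for z
  have nz: "1 - cnj (c 0) * G z \<noteq> 0" if "z \<in> ball 0 1" for z
  proof -
    have "cmod (cnj (c 0) * G z) < 1"
      using norm_mult_less[of "cnj (c 0)" 1 "G z" 1] G_less[OF that] c0 by simp
    then show ?thesis by auto
  qed
  have "N holomorphic_on ball 0 1"
    unfolding N_def
  proof (intro holomorphic_intros)
    show "q holomorphic_on ball 0 1"
      by (rule power_series_holomorphic) (use q in \<open>simp only: diff_zero\<close>)
    show "G holomorphic_on ball 0 1"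
      by (rule power_series_holomorphic) (use G_sums in \<open>simp only: diff_zero\<close>)
  qed (use nz in auto)
  moreover have "cmod (z ^ n * N z) \<le> 1" if "z \<in> ball 0 1" for z
    using Moebius_function_norm_lt_1[OF c0 G_less[OF that], of 0] Gq[OF that]
    by (simp add: Moebius_function_simple N_def)
  ultimately have "cmod (N 0) \<le> 1"
    by (rule norm_le_one_of_norm_power_mult_le_one) simp_all
  moreover have "q 0 = c n"
    using q[of 0] n en by simp
  moreover have "G 0 = c 0"
    using G_sums[of 0] e0 by simp
  moreover have "cmod (1 - cnj (c 0) * c 0) = 1 - (cmod (c 0))\<^sup>2"
  proof -
    have "1 - cnj (c 0) * c 0 = of_real (1 - (cmod (c 0))\<^sup>2)"
      by (simp only: of_real_diff of_real_1 complex_norm_square) (simp add: mult.commute)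
    then show ?thesis using c0 by (simp only: norm_of_real) (simp add: abs_square_le_1)
  qed
  moreover have "(cmod (c 0))\<^sup>2 < 1"
    using c0 by (simp add: abs_square_less_1)
  ultimately show ?thesis
    by (simp add: N_def norm_divide)
qed

text \<open>Scaling \<open>g\<close> by \<open>t < 1\<close> makes its bound strict, so that the
  Moebius argument applies; the inequality survives the limit as \<open>t\<close> tends to 1. This
  covers unimodular constants.\<close>

lemma norm_coeff_le:
  fixes c :: "nat \<Rightarrow> complex"
  assumes sums: "\<And>z. z \<in> ball 0 1 \<Longrightarrow> (\<lambda>n. c n * z ^ n) sums g z"
    and le: "\<And>z. z \<in> ball 0 1 \<Longrightarrow> cmod (g z) \<le> 1"
    and n: "n > 0"
  shows "cmod (c n) \<le> 1 - (cmod (c 0))\<^sup>2"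
proof -
  have "t * cmod (c n) \<le> 1 - (t * cmod (c 0))\<^sup>2" if "0 < t" "t < 1" for t :: real
  proof -
    have "(\<lambda>n. (of_real t * c n) * z ^ n) sums (of_real t * g z)" if "z \<in> ball 0 1" for z
      using sums_mult[OF sums[OF that], of "of_real t"] by (simp add: mult.assoc)
    moreover have "cmod (of_real t * g z) < 1" if "z \<in> ball 0 1" for z
    proof -
      have "cmod (of_real t * g z) \<le> t * 1"
        using le[OF that] \<open>0 < t\<close> by (simp add: norm_mult)
      with \<open>t < 1\<close> show ?thesis by simp
    qed
    ultimately have "cmod (of_real t * c n) \<le> 1 - (cmod (of_real t * c 0))\<^sup>2"
      using n by (rule norm_coeff_le_strict)
    with that show ?thesis by (simp add: norm_mult)
  qed
  then have "\<forall>\<^sub>F t in at_left 1. t * cmod (c n) \<le> 1 - (t * cmod (c 0))\<^sup>2"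
    by (auto simp: eventually_at_left_field intro!: exI[of _ 0])
  moreover have "((\<lambda>t. t * cmod (c n)) \<longlongrightarrow> 1 * cmod (c n)) (at_left 1)"
    "((\<lambda>t. 1 - (t * cmod (c 0))\<^sup>2) \<longlongrightarrow> 1 - (1 * cmod (c 0))\<^sup>2) (at_left 1)"
    by (intro tendsto_intros)+
  ultimately have "1 * cmod (c n) \<le> 1 - (1 * cmod (c 0))\<^sup>2"
    by (intro tendsto_le[OF trivial_limit_at_left_real])
  then show ?thesis by simp
qed

section \<open>Schwarz functions: growth, coefficients, derivative\<close>

text \<open>After division by \<open>z ^ m\<close> the cofactor is still bounded by 1.\<close>

lemma schwarz_lemma_order:
  assumes "\<omega> \<in> unit_bounded_order m" "z \<in> ball 0 1"
  shows "cmod (\<omega> z) \<le> cmod z ^ m"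
proof -
  from assms have hol: "\<omega> holomorphic_on ball 0 1"
    and le: "\<And>z. z \<in> ball 0 1 \<Longrightarrow> cmod (\<omega> z) \<le> 1"
    and zero: "\<And>k. k < m \<Longrightarrow> taylor_coeff \<omega> k = 0"
    by (auto simp: unit_bounded_order_def unit_bounded_def taylor_coeff_def fps_expansion_def)
  obtain g where
    g: "\<And>z. z \<in> ball 0 1 \<Longrightarrow> (\<lambda>n. taylor_coeff \<omega> (n + m) * z ^ n) sums g z"
    and \<omega>: "\<And>z. z \<in> ball 0 1 \<Longrightarrow> \<omega> z = z ^ m * g z"
    by (rule sums_shift_factor[OF taylor_coeff_sums[OF hol] zero]) blast+
  have "g holomorphic_on ball 0 1"
    by (rule power_series_holomorphic) (use g in \<open>simp only: diff_zero\<close>)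
  then have "cmod (g z) \<le> 1"
    by (rule norm_le_one_of_norm_power_mult_le_one) (use \<omega> le assms(2) in simp_all)
  then show ?thesis
    using \<omega>[OF assms(2)] by (simp add: norm_mult norm_power mult_left_le)
qed

lemma schwarz_function_coeff_le:
  assumes "schwarz_function f"
  shows "cmod (taylor_coeff f (n + 2)) \<le> 1 - (cmod (taylor_coeff f 1))\<^sup>2"
    and "cmod (taylor_coeff f 1) \<le> 1"
proof -
  from assms have hol: "f holomorphic_on ball 0 1"
    and le: "\<And>z. z \<in> ball 0 1 \<Longrightarrow> cmod (f z) \<le> 1"
    and zero: "\<And>k. k < 1 \<Longrightarrow> taylor_coeff f k = 0"
    by (auto simp: schwarz_function_def unit_bounded_def taylor_coeff_def fps_expansion_def)
  obtain g where
    g: "\<And>z. z \<in> ball 0 1 \<Longrightarrow> (\<lambda>n. taylor_coeff f (n + 1) * z ^ n) sums g z"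
    and f: "\<And>z. z \<in> ball 0 1 \<Longrightarrow> f z = z ^ 1 * g z"
    by (rule sums_shift_factor[OF taylor_coeff_sums[OF hol] zero]) blast+
  have "g holomorphic_on ball 0 1"
    by (rule power_series_holomorphic) (use g in \<open>simp only: diff_zero\<close>)
  then have g_le: "cmod (g z) \<le> 1" if "z \<in> ball 0 1" for z
    by (rule norm_le_one_of_norm_power_mult_le_one[where m = 1]) (use f le that in auto)
  \<comment> \<open>Indices drop by one from \<open>f\<close> to \<open>g\<close>:
    \<open>n + 2\<close> becomes the positive index \<open>Suc n\<close>, and 1 becomes the constant
    term.\<close>
  from norm_coeff_le[OF g g_le, of "Suc n"]
  show "cmod (taylor_coeff f (n + 2)) \<le> 1 - (cmod (taylor_coeff f 1))\<^sup>2"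
    by simp
  show "cmod (taylor_coeff f 1) \<le> 1"
    using g[of 0] g_le[of 0] by simp
qed

text \<open>The difference is the sum of (n+2) a_(n+2) w^(n+1) over n \<ge> 0. The coefficient bound
  leaves the differentiated geometric series without its first term, whence the
  \<open>- 1\<close>.\<close>

lemma schwarz_function_deriv_le:
  assumes "schwarz_function f" and w: "w \<in> ball 0 1"
  shows "cmod (deriv f w - taylor_coeff f 1)
           \<le> (1 - (cmod (taylor_coeff f 1))\<^sup>2) * (1 / (1 - cmod w)\<^sup>2 - 1)"
proof -
  let ?c = "1 - (cmod (taylor_coeff f 1))\<^sup>2"
  have hol: "f holomorphic_on ball 0 1"
    using assms by (simp add: schwarz_function_def unit_bounded_def)
  have coeff: "taylor_coeff (deriv f) n = of_nat (Suc n) * taylor_coeff f (Suc n)" for n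
    by (simp add: taylor_coeff_def fps_expansion_def funpow_Suc_right del: funpow.simps of_nat_Suc)
  have "(\<lambda>n. taylor_coeff (deriv f) n * w ^ n) sums deriv f w"
    by (rule taylor_coeff_sums[OF holomorphic_deriv[OF hol] w]) simp
  then have "(\<lambda>n. taylor_coeff (deriv f) (n + 1) * w ^ (n + 1)) sums
      (deriv f w - (\<Sum>i<1. taylor_coeff (deriv f) i * w ^ i))"
    by (rule sums_split_initial_segment)
  then have "(\<lambda>n. of_nat (n + 2) * taylor_coeff f (n + 2) * w ^ (n + 1)) sums
      (deriv f w - taylor_coeff f 1)"
    by (simp add: coeff)
  moreover have "(\<lambda>n. ?c * (real (Suc (n + 1)) * cmod w ^ (n + 1))) sums
      (?c * (1 / (1 - cmod w)\<^sup>2 - (\<Sum>i<1. real (Suc i) * cmod w ^ i)))"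
    using w by (intro sums_mult sums_split_initial_segment geometric_deriv_sums) simp
  moreover have "cmod (of_nat (n + 2) * taylor_coeff f (n + 2) * w ^ (n + 1))
      \<le> ?c * (real (Suc (n + 1)) * cmod w ^ (n + 1))" for n
    using mult_right_mono[OF schwarz_function_coeff_le(1)[OF assms(1), of n],
        of "real (n + 2) * cmod w ^ (n + 1)"]
    by (simp add: norm_mult norm_power mult_ac del: of_nat_add of_nat_Suc)
  ultimately have "cmod (deriv f w - taylor_coeff f 1)
      \<le> ?c * (1 / (1 - cmod w)\<^sup>2 - (\<Sum>i<1. real (Suc i) * cmod w ^ i))"
    by (rule norm_sums_le)
  then show ?thesis by simp
qed

section \<open>Comparison of \<open>a powr p\<close> with \<open>a\<^sup>2\<close>\<close>

text \<open>For \<open>p / 2 \<le> 1\<close> the function x powr (p/2) is concave, so it lies below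
  its tangent at x = 1; take x = a^2. Young's inequality with weights \<open>p / 2\<close> and
  \<open>1 - p / 2\<close> expresses this for a > 0; at a = 0 the claim is
  \<open>p / 2 \<le> 1\<close>.\<close>

lemma powr_le_bernoulli:
  fixes a p :: real
  assumes "0 \<le> a" "0 < p" "p \<le> 2"
  shows "a powr p \<le> 1 - p / 2 * (1 - a\<^sup>2)"
proof (cases "a = 0")
  case False
  then have "(a\<^sup>2) powr (p / 2) * 1 powr (1 - p / 2) \<le> p / 2 * a\<^sup>2 + (1 - p / 2) * 1"
    using assms by (intro Youngs_inequality_0) auto
  moreover have "(a\<^sup>2) powr (p / 2) = a powr p"
    using assms(1) False powr_powr[of a 2 "p / 2"] by simp
  ultimately show ?thesis by (simp add: algebra_simps)
qed (use assms in simp)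

text \<open>The derivative of \<open>a powr p\<close> at 1 is \<open>p\<close>, and
  \<open>1 - a\<^sup>2\<close> contributes the further factor \<open>1 + a\<close>, tending to 2.
  Thus the constant \<open>p / 2\<close> of the preceding inequality is sharp near 1.\<close>

lemma tendsto_powr_quotient:
  fixes p :: real
  shows "((\<lambda>a. (1 - a powr p) / (1 - a\<^sup>2)) \<longlongrightarrow> p / 2) (at_left 1)"
proof -
  have "((\<lambda>a. a powr p) has_real_derivative p * 1 powr (p - 1)) (at 1)"
    by (rule has_real_derivative_powr) simp
  then have "((\<lambda>a. (a powr p - 1) / (a - 1)) \<longlongrightarrow> p) (at 1)"
    by (simp add: has_field_derivative_iff)
  then have "((\<lambda>a. (a powr p - 1) / (a - 1)) \<longlongrightarrow> p) (at_left 1)"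
    by (rule tendsto_mono[OF at_le[OF subset_UNIV]])
  moreover have "((\<lambda>a::real. 1 + a) \<longlongrightarrow> 1 + 1) (at_left 1)"
    by (intro tendsto_intros)
  ultimately have "((\<lambda>a. (a powr p - 1) / (a - 1) / (1 + a)) \<longlongrightarrow> p / (1 + 1)) (at_left 1)"
    by (rule tendsto_divide) simp
  \<comment> \<open>True for every real \<open>a\<close>: at 1 and -1 both sides are 0, as division
    by 0 yields 0.\<close>
  moreover have "(a powr p - 1) / (a - 1) / (1 + a) = (1 - a powr p) / (1 - a\<^sup>2)" for a :: real
  proof -
    have "(a powr p - 1) / (a - 1) / (1 + a) = (- (1 - a powr p)) / (- (1 - a\<^sup>2))"
      by (simp add: power2_eq_square algebra_simps)
    then show ?thesis by (simp only: minus_divide_divide)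
  qed
  ultimately show ?thesis by simp
qed

section \<open>Extremal functions\<close>

text \<open>This is \<open>z\<close> times the disc automorphism exchanging 0 and \<open>a\<close>.
  Beyond the first, its nonzero coefficients are negative reals, so nothing cancels at positive
  points, and each nearly attains the coefficient bound for \<open>a\<close> close to 1.\<close>

definition schwarz_extremal :: "real \<Rightarrow> complex \<Rightarrow> complex" where
  "schwarz_extremal a z = z * ((of_real a - z) / (1 - of_real a * z))"

lemma one_minus_mult_nonzero:
  fixes z :: complex
  assumes "0 < a" "a < 1" "z \<in> ball 0 1"
  shows "1 - of_real a * z \<noteq> 0"
  using norm_mult_less[of "of_real a" 1 z 1] assms by auto

lemma schwarz_function_extremal:
  assumes "0 < a" "a < 1"
  shows "schwarz_function (schwarz_extremal a)"
proof -
  note nz = one_minus_mult_nonzero[OF assms]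
  have "schwarz_extremal a holomorphic_on ball 0 1"
    unfolding schwarz_extremal_def using nz by (intro holomorphic_intros) auto
  moreover have "cmod (schwarz_extremal a z) \<le> 1" if "z \<in> ball 0 1" for z
  proof -
    have "cmod ((of_real a - z) / (1 - of_real a * z)) < 1"
      using Moebius_function_norm_lt_1[of "of_real a" z 0] assms that
      by (simp add: Moebius_function_simple norm_divide norm_minus_commute)
    then have "cmod (schwarz_extremal a z) < 1 * 1"
      unfolding schwarz_extremal_def using that by (intro norm_mult_less) auto
    then show ?thesis by simp
  qed
  ultimately show ?thesis
    by (simp add: schwarz_function_def unit_bounded_def schwarz_extremal_def)
qed

text \<open>Use (a - z)/(1 - az) = a - (1 - a^2) z/(1 - az), multiply by z and expand the last
  fraction geometrically.\<close>

lemma taylor_coeff_extremal: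
  assumes "0 < a" "a < 1"
  shows "taylor_coeff (schwarz_extremal a) 1 = of_real a"
    and "taylor_coeff (schwarz_extremal a) (n + 2) = - of_real ((1 - a\<^sup>2) * a ^ n)"
proof -
  define c :: "nat \<Rightarrow> complex" where
    "c n = (if n = 0 then 0 else if n = 1 then of_real a
            else - of_real ((1 - a\<^sup>2) * a ^ (n - 2)))" for n
  have sums: "(\<lambda>n. c n * z ^ n) sums schwarz_extremal a z" if z: "z \<in> ball 0 1" for z
  proof -
    have nz: "1 - of_real a * z \<noteq> 0"
      by (rule one_minus_mult_nonzero[OF assms z])
    have "cmod (of_real a * z) < 1"
      using norm_mult_less[of "of_real a" 1 z 1] assms z by auto
    note sums_mult[OF geometric_sums[OF this], of "- of_real (1 - a\<^sup>2) * z\<^sup>2"]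
    moreover have "- of_real (1 - a\<^sup>2) * z\<^sup>2 * (of_real a * z) ^ n = c (n + 2) * z ^ (n + 2)" for n
      by (simp add: c_def power_mult_distrib power2_eq_square algebra_simps)
    ultimately have "(\<lambda>n. c (n + 2) * z ^ (n + 2)) sums
        (- of_real (1 - a\<^sup>2) * z\<^sup>2 * (1 / (1 - of_real a * z)))"
      by (simp only:)
    from sums_iff_shift[THEN iffD1, OF this]
    have "(\<lambda>n. c n * z ^ n) sums
        (- of_real (1 - a\<^sup>2) * z\<^sup>2 * (1 / (1 - of_real a * z)) + (\<Sum>i<2. c i * z ^ i))" .
    also have "- of_real (1 - a\<^sup>2) * z\<^sup>2 * (1 / (1 - of_real a * z)) + (\<Sum>i<2. c i * z ^ i)
        = schwarz_extremal a z"
      using nz by (simp add: c_def schwarz_extremal_def numeral_2_eq_2 field_simps)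
    finally show ?thesis .
  qed
  note taylor_coeff_unique[OF sums]
  then show "taylor_coeff (schwarz_extremal a) 1 = of_real a"
    and "taylor_coeff (schwarz_extremal a) (n + 2) = - of_real ((1 - a\<^sup>2) * a ^ n)"
    by (simp_all add: c_def)
qed

text \<open>The difference is a nonpositive real, so the modulus only drops the sign. Divided by
  \<open>1 - a\<^sup>2\<close> it tends, as \<open>a\<close> tends to 1, to the last term of
  \<open>Psi\<close> with \<open>t = r ^ m\<close>.\<close>

lemma deriv_extremal:
  assumes a: "0 < a" "a < 1" and t: "0 \<le> t" "t < 1"
  shows "cmod (deriv (schwarz_extremal a) (of_real t) - of_real a)
           = (1 - a\<^sup>2) * (t * (2 - a * t) / (1 - a * t)\<^sup>2)"
proof -
  have at: "a * t < 1" using mult_strict_mono[of a 1 t 1] a t by simp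
  define z :: complex where "z = of_real t"
  define b :: complex where "b = of_real a"
  define d where "d = 1 - b * z"
  have d: "d \<noteq> 0"
    unfolding d_def b_def by (rule one_minus_mult_nonzero[OF a]) (use t in \<open>simp add: z_def\<close>)
  have "((\<lambda>w. (b - w) / (1 - b * w)) has_field_derivative
      ((- 1) * d - (b - z) * (- b)) / (d * d)) (at z)"
    unfolding d_def
    by (rule DERIV_divide) (use d in \<open>auto simp: d_def intro!: derivative_eq_intros\<close>)
  from DERIV_mult[OF DERIV_ident this]
  have "deriv (schwarz_extremal a) z = (b - z) / d + ((- 1) * d - (b - z) * (- b)) / (d * d) * z"
    unfolding schwarz_extremal_def b_def[symmetric]
    by (intro DERIV_imp_deriv) (simp add: d_def)
  also have "\<dots> - b = ((b - z) * d + ((- 1) * d - (b - z) * (- b)) * z - b * (d * d)) / d\<^sup>2"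
    using d by (simp add: field_simps power2_eq_square)
  also have "(b - z) * d + ((- 1) * d - (b - z) * (- b)) * z - b * (d * d)
      = - ((1 - b\<^sup>2) * (z * (2 - b * z)))"
    unfolding d_def by (simp add: algebra_simps power2_eq_square)
  also have "- ((1 - b\<^sup>2) * (z * (2 - b * z))) / d\<^sup>2 = - of_real ((1 - a\<^sup>2) * (t * (2 - a * t) / (1 - a * t)\<^sup>2))"
    by (simp add: z_def b_def d_def)
  finally have "cmod (deriv (schwarz_extremal a) z - b)
      = \<bar>(1 - a\<^sup>2) * (t * (2 - a * t) / (1 - a * t)\<^sup>2)\<bar>"
    by (simp only: norm_minus_cancel norm_of_real)
  also have "\<dots> = (1 - a\<^sup>2) * (t * (2 - a * t) / (1 - a * t)\<^sup>2)"
    using a t at by (intro abs_of_nonneg mult_nonneg_nonneg divide_nonneg_nonneg) (auto simp: power_le_one)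
  finally show ?thesis by (simp add: z_def b_def)
qed

lemma power_mem_unit_bounded_order: "(\<lambda>z. z ^ m) \<in> unit_bounded_order m"
proof -
  \<comment> \<open>The factor \<open>0 ^ (m - k)\<close> vanishes for \<open>k < m\<close>; for
    \<open>k = m\<close> it is 1, and the Pochhammer symbol of 1 is m!.\<close>
  have "(deriv ^^ k) (\<lambda>z::complex. z ^ m) 0 = pochhammer (of_nat (Suc m - k)) k * 0 ^ (m - k)" for k
    using higher_deriv_power[of k 0 m 0] by simp
  moreover have "pochhammer (1 :: complex) m \<noteq> 0"
    by (simp flip: pochhammer_fact)
  moreover have "(\<lambda>z::complex. z ^ m) holomorphic_on ball 0 1"
    by (intro holomorphic_intros)
  ultimately show ?thesis
    by (simp add: unit_bounded_order_def unit_bounded_def norm_power power_le_one)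
qed

section \<open>The upper bound\<close>

text \<open>This trades extended-real subtraction for a comparison with a real number. Nonnegative
  terms keep the series away from -\<infinity>; if it is \<infinity>, then \<open>Psi\<close> is
  -\<infinity> and both sides fail.\<close>

lemma Psi_nonneg_iff:
  assumes "\<phi> \<in> weight_seqs" "0 \<le> r" "r < 1"
  shows "0 \<le> Psi m p \<phi> r \<longleftrightarrow>
    (\<Sum>n. ereal ((real (Suc n) + 1) * \<phi> (Suc n) r))
      \<le> ereal (p / 2 * \<phi> 0 r - r ^ m * ((2 - r ^ m) / (1 - r ^ m)\<^sup>2))"
proof -
  have "0 \<le> (\<Sum>n. ereal ((real (Suc n) + 1) * \<phi> (Suc n) r))"
    using assms by (intro suminf_0_le) (simp add: weight_seqs_def)
  then show ?thesis
    unfolding Psi_def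
    by (cases "\<Sum>n. ereal ((real (Suc n) + 1) * \<phi> (Suc n) r)") (auto simp: zero_ereal_def)
qed

text \<open>The left side increases with \<open>s\<close> and equals the right side at
  \<open>s = t\<close>; with \<open>t = r ^ m\<close> the right side is the last term of
  \<open>Psi\<close>.\<close>

lemma inverse_square_mono:
  fixes s t :: real
  assumes "s \<le> t" "t < 1"
  shows "1 / (1 - s)\<^sup>2 - 1 \<le> t * ((2 - t) / (1 - t)\<^sup>2)"
proof -
  have "1 / (1 - s)\<^sup>2 - 1 \<le> 1 / (1 - t)\<^sup>2 - 1"
    using assms by (intro diff_right_mono divide_left_mono power_mono) auto
  also have "\<dots> = t * ((2 - t) / (1 - t)\<^sup>2)"
    using assms by (simp add: divide_simps) (simp add: power2_eq_square algebra_simps)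
  finally show ?thesis .
qed

lemma D_deriv_le:
  assumes m: "m \<ge> 1" and p: "0 < p" "p \<le> 2" and \<phi>: "\<phi> \<in> weight_seqs"
    and f: "schwarz_function f" and \<omega>: "\<omega> \<in> unit_bounded_order m"
    and z: "z \<in> ball 0 1" and Psi: "0 \<le> Psi m p \<phi> (cmod z)"
  shows "D_deriv f \<omega> \<phi> p z \<le> ereal (\<phi> 0 (cmod z))"
proof -
  define r where "r = cmod z"
  define a where "a = cmod (taylor_coeff f 1)"
  define B where "B = r ^ m * ((2 - r ^ m) / (1 - r ^ m)\<^sup>2)"
  define S where "S = (\<Sum>n. ereal ((real (Suc n) + 1) * \<phi> (Suc n) r))"
  have r: "0 \<le> r" "r < 1" using z by (simp_all add: r_def)
  have rm: "r ^ m < 1" using r m by (simp add: power_less_one_iff)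
  have \<phi>_nonneg: "0 \<le> \<phi> n r" for n
    using \<phi> r by (simp add: weight_seqs_def)
  have a: "0 \<le> a" "a \<le> 1"
    using schwarz_function_coeff_le(2)[OF f] by (simp_all add: a_def)
  then have a2: "0 \<le> 1 - a\<^sup>2" by (simp add: power_le_one)
  have \<omega>z: "cmod (\<omega> z) \<le> r ^ m"
    using schwarz_lemma_order[OF \<omega> z] by (simp add: r_def)
  have "cmod (deriv f (\<omega> z) - taylor_coeff f 1) \<le> (1 - a\<^sup>2) * (1 / (1 - cmod (\<omega> z))\<^sup>2 - 1)"
    using schwarz_function_deriv_le[OF f, of "\<omega> z"] \<omega>z rm by (simp add: a_def)
  also have "\<dots> \<le> (1 - a\<^sup>2) * B"
    unfolding B_def by (intro mult_left_mono inverse_square_mono \<omega>z rm a2)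
  finally have deriv_le: "cmod (deriv f (\<omega> z) - taylor_coeff f 1) \<le> (1 - a\<^sup>2) * B" .
  have "(\<Sum>n. ereal ((real (Suc n) + 1) * cmod (taylor_coeff f (Suc n + 1)) * \<phi> (Suc n) r))
      \<le> (\<Sum>n. ereal (1 - a\<^sup>2) * ereal ((real (Suc n) + 1) * \<phi> (Suc n) r))"
  proof (rule suminf_le_pos)
    fix n
    have "(real (Suc n) + 1) * \<phi> (Suc n) r * cmod (taylor_coeff f (n + 2))
        \<le> (real (Suc n) + 1) * \<phi> (Suc n) r * (1 - a\<^sup>2)"
      unfolding a_def using \<phi>_nonneg
      by (intro mult_left_mono schwarz_function_coeff_le f) simp_all
    then show "ereal ((real (Suc n) + 1) * cmod (taylor_coeff f (Suc n + 1)) * \<phi> (Suc n) r)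
        \<le> ereal (1 - a\<^sup>2) * ereal ((real (Suc n) + 1) * \<phi> (Suc n) r)"
      by (simp add: mult_ac)
  qed (use \<phi>_nonneg in simp)
  also have "\<dots> = ereal (1 - a\<^sup>2) * S"
    unfolding S_def using a2 \<phi>_nonneg by (intro suminf_cmult_ereal) simp_all
  \<comment> \<open>The sign of \<open>Psi\<close> enters here; the \<open>- B\<close> it brings
    cancels the contribution of \<open>deriv_le\<close> in the final sum.\<close>
  also have "\<dots> \<le> ereal (1 - a\<^sup>2) * ereal (p / 2 * \<phi> 0 r - B)"
    using Psi a2 unfolding S_def B_def r_def[symmetric] Psi_nonneg_iff[OF \<phi> r]
    by (intro ereal_mult_left_mono) auto
  finally have series_le: "(\<Sum>n. ereal ((real (Suc n) + 1) * cmod (taylor_coeff f (Suc n + 1)) * \<phi> (Suc n) r))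
      \<le> ereal ((1 - a\<^sup>2) * (p / 2 * \<phi> 0 r - B))"
    by simp
  have "D_deriv f \<omega> \<phi> p z \<le> ereal (a powr p * \<phi> 0 r)
      + ereal ((1 - a\<^sup>2) * (p / 2 * \<phi> 0 r - B)) + ereal ((1 - a\<^sup>2) * B)"
    unfolding D_deriv_def a_def[symmetric] r_def[symmetric]
    using deriv_le by (intro add_mono series_le) auto
  also have "\<dots> = ereal ((a powr p + p / 2 * (1 - a\<^sup>2)) * \<phi> 0 r)"
    by (simp add: field_simps)
  also have "\<dots> \<le> ereal (\<phi> 0 r)"
    using mult_right_mono[OF powr_le_bernoulli[OF a(1) p] \<phi>_nonneg[of 0]]
    by (simp add: algebra_simps)
  finally show ?thesis by (simp add: r_def)
qed

section \<open>Sharpness\<close>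

lemma D_deriv_extremal_gt:
  assumes m: "m \<ge> 1" and \<phi>: "\<phi> \<in> weight_seqs"
    and r: "0 \<le> r" "r < 1" and Psi: "Psi m p \<phi> r < 0"
  obtains a where "0 < a" "a < 1"
    "D_deriv (schwarz_extremal a) (\<lambda>z. z ^ m) \<phi> p (of_real r) > ereal (\<phi> 0 r)"
proof -
  define t where "t = r ^ m"
  \<comment> \<open>\<open>(1 - a\<^sup>2) * K N a\<close> is what the extremal function contributes
    beyond the \<open>\<phi> 0\<close> term, with the series cut after \<open>N\<close> terms. A
    finite sum can be passed to the limit at \<open>a = 1\<close> term by term.\<close>
  define K where
    "K N a = (\<Sum>n<N. (real (Suc n) + 1) * a ^ n * \<phi> (Suc n) r) + t * (2 - a * t) / (1 - a * t)\<^sup>2"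
    for N a
  have t: "0 \<le> t" "t < 1" using r m by (simp_all add: t_def power_less_one_iff)
  have \<phi>_nonneg: "0 \<le> \<phi> n r" for n
    using \<phi> r by (simp add: weight_seqs_def)
  \<comment> \<open>If no section sufficed, all partial sums and hence the series would be bounded
    so as to give \<open>Psi \<ge> 0\<close>. This includes the divergent case.\<close>
  obtain N where N: "p / 2 * \<phi> 0 r < K N 1"
  proof (rule ccontr)
    assume "\<not> thesis"
    then have "K N 1 \<le> p / 2 * \<phi> 0 r" for N using that by (meson not_le)
    then have "(\<Sum>n<N. (real (Suc n) + 1) * \<phi> (Suc n) r) \<le> p / 2 * \<phi> 0 r - t * ((2 - t) / (1 - t)\<^sup>2)" for N
      by (simp add: K_def le_diff_eq)
    then have "(\<Sum>n. ereal ((real (Suc n) + 1) * \<phi> (Suc n) r))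
        \<le> ereal (p / 2 * \<phi> 0 r - t * ((2 - t) / (1 - t)\<^sup>2))"
      using \<phi>_nonneg by (intro suminf_bound) (simp_all only: sum_ereal ereal_less_eq, auto)
    then have "0 \<le> Psi m p \<phi> r"
      unfolding Psi_nonneg_iff[OF \<phi> r] t_def .
    with Psi show False by simp
  qed
  have "((\<lambda>a. K N a - (1 - a powr p) / (1 - a\<^sup>2) * \<phi> 0 r) \<longlongrightarrow> K N 1 - p / 2 * \<phi> 0 r) (at_left 1)"
    unfolding K_def using t by (intro tendsto_intros tendsto_powr_quotient) auto
  then have "\<forall>\<^sub>F a in at_left 1. 0 < K N a - (1 - a powr p) / (1 - a\<^sup>2) * \<phi> 0 r"
    by (rule order_tendstoD) (use N in simp)
  moreover have "\<forall>\<^sub>F a::real in at_left 1. 0 < a \<and> a < 1"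
    by (auto simp: eventually_at_left_field intro!: exI[of _ 0])
  ultimately have "\<forall>\<^sub>F a in at_left 1. 0 < a \<and> a < 1 \<and> (1 - a powr p) / (1 - a\<^sup>2) * \<phi> 0 r < K N a"
    by eventually_elim simp
  then obtain a where a: "0 < a" "a < 1" and K: "(1 - a powr p) / (1 - a\<^sup>2) * \<phi> 0 r < K N a"
    using eventually_happens'[OF trivial_limit_at_left_real] by blast
  have a2: "0 < 1 - a\<^sup>2" using a by (simp add: abs_square_less_1)
  have "\<phi> 0 r < a powr p * \<phi> 0 r + (1 - a\<^sup>2) * K N a"
    using K a2 by (simp add: field_simps)
  then have "ereal (\<phi> 0 r) < ereal (a powr p * \<phi> 0 r + (1 - a\<^sup>2) * K N a)"
    by simp
  also have "\<dots> = ereal (a powr p * \<phi> 0 r)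
      + (\<Sum>n<N. ereal ((real (Suc n) + 1) * ((1 - a\<^sup>2) * a ^ n) * \<phi> (Suc n) r))
      + ereal ((1 - a\<^sup>2) * (t * (2 - a * t) / (1 - a * t)\<^sup>2))"
    by (simp only: K_def distrib_left[of "1 - a\<^sup>2"] sum_distrib_left mult_ac add.assoc plus_ereal.simps sum_ereal)
  \<comment> \<open>The tail that was cut off has nonnegative terms.\<close>
  also have "\<dots> \<le> ereal (a powr p * \<phi> 0 r)
      + (\<Sum>n. ereal ((real (Suc n) + 1) * ((1 - a\<^sup>2) * a ^ n) * \<phi> (Suc n) r))
      + ereal ((1 - a\<^sup>2) * (t * (2 - a * t) / (1 - a * t)\<^sup>2))"
    using a a2 \<phi>_nonneg by (intro add_mono order_refl suminf_upper) simp
  also have "\<dots> = D_deriv (schwarz_extremal a) (\<lambda>z. z ^ m) \<phi> p (of_real r)"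
  proof -
    have "cmod (taylor_coeff (schwarz_extremal a) (Suc n + 1)) = (1 - a\<^sup>2) * a ^ n" for n
    proof -
      have "Suc n + 1 = n + 2" by simp
      then show ?thesis
        using a a2 by (simp only: taylor_coeff_extremal[OF a] norm_minus_cancel norm_of_real) simp
    qed
    moreover have "cmod (deriv (schwarz_extremal a) (of_real r ^ m) - of_real a)
        = (1 - a\<^sup>2) * (t * (2 - a * t) / (1 - a * t)\<^sup>2)"
      using deriv_extremal[OF a t] by (simp add: t_def)
    ultimately show ?thesis
      unfolding D_deriv_def taylor_coeff_extremal(1)[OF a] using a r by simp
  qed
  finally show thesis using a that by blast
qed

theorem theorem4:
  fixes m :: nat and p R4 :: real and \<phi> :: "nat \<Rightarrow> real \<Rightarrow> real"
  assumes "m \<ge> 1" and "0 < p" and "p \<le> 2" and "\<phi> \<in> weight_seqs"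
    and "minimal_positive_root (Psi m p \<phi>) R4"
  shows "((\<forall>r. 0 \<le> r \<and> r \<le> R4 \<longrightarrow> Psi m p \<phi> r \<ge> 0) \<longrightarrow>
           (\<forall>f \<omega> z. schwarz_function f \<and> \<omega> \<in> unit_bounded_order m \<and>
                    z \<in> ball 0 1 \<and> cmod z \<le> R4 \<longrightarrow>
              D_deriv f \<omega> \<phi> p z \<le> ereal (\<phi> 0 (cmod z)))) \<and>
         ((\<exists>\<epsilon>>0. R4 + \<epsilon> \<le> 1 \<and> (\<forall>r. R4 < r \<and> r < R4 + \<epsilon> \<longrightarrow> Psi m p \<phi> r < 0)) \<longrightarrow>
           (\<forall>R'. R4 < R' \<and> R' \<le> 1 \<longrightarrow>
              (\<exists>f \<omega> z. schwarz_function f \<and> \<omega> \<in> unit_bounded_order m \<and>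
                       z \<in> ball 0 1 \<and> cmod z < R' \<and>
                 D_deriv f \<omega> \<phi> p z > ereal (\<phi> 0 (cmod z)))))"
proof (intro conjI impI allI; elim exE conjE)
  have R4: "0 < R4" "R4 < 1"
    using assms(5) by (auto simp: minimal_positive_root_def)
  show "D_deriv f \<omega> \<phi> p z \<le> ereal (\<phi> 0 (cmod z))"
    if "\<forall>r. 0 \<le> r \<and> r \<le> R4 \<longrightarrow> Psi m p \<phi> r \<ge> 0" "schwarz_function f"
      "\<omega> \<in> unit_bounded_order m" "z \<in> ball 0 1" "cmod z \<le> R4" for f \<omega> z
    using assms that by (intro D_deriv_le) auto
  show "\<exists>f \<omega> z. schwarz_function f \<and> \<omega> \<in> unit_bounded_order m \<and>
      z \<in> ball 0 1 \<and> cmod z < R' \<and> D_deriv f \<omega> \<phi> p z > ereal (\<phi> 0 (cmod z))"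
    if "\<epsilon> > 0" "\<forall>r. R4 < r \<and> r < R4 + \<epsilon> \<longrightarrow> Psi m p \<phi> r < 0" "R4 < R'" "R' \<le> 1" for \<epsilon> R'
  proof -
    \<comment> \<open>Below \<open>R'\<close> the point \<open>z = r\<close> is admissible, with
      \<open>r < 1\<close> from \<open>R' \<le> 1\<close>; below \<open>R4 + \<epsilon>\<close> the
      function \<open>Psi\<close> is negative.\<close>
    obtain r where r: "R4 < r" "r < min R' (R4 + \<epsilon>)"
      using dense[of R4 "min R' (R4 + \<epsilon>)"] \<open>\<epsilon> > 0\<close> \<open>R4 < R'\<close> by auto
    then have r': "0 \<le> r" "r < 1" "Psi m p \<phi> r < 0"
      using that R4 by auto
    obtain a where "0 < a" "a < 1"
      "D_deriv (schwarz_extremal a) (\<lambda>z. z ^ m) \<phi> p (of_real r) > ereal (\<phi> 0 r)"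
      using D_deriv_extremal_gt[OF assms(1,4) r'] by blast
    then show ?thesis
      using r r' schwarz_function_extremal power_mem_unit_bounded_order
      by (intro exI[of _ "schwarz_extremal a"] exI[of _ "\<lambda>z. z ^ m"] exI[of _ "of_real r"]) auto
  qed
qed

end
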